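(* Let $p$ be a positive integer. Then for every real or complex number $x$, $$M(x,p) = e^x \int_0^x \varphi_{p+1}(t)\,\frac{dt}{t} = e^x \sum_{k=1}^{p+1} \frac{1}{k}\, S(p+1,k)\, x^k,$$ where $M(x,p)=\sum_{n=1}^{\infty}\left(1^p+2^p+\dots+n^p\right)\frac{x^n}{n!}$.
   Context: $S(m,k)$ denotes the Stirling numbers of the second kind. The exponential polynomials are $\varphi_m(x)=\sum_{k=0}^{m} S(m,k)x^k$ for integers $m\ge 0$, so $\varphi_0(x)=1$, $\varphi_1(x)=x$, $\varphi_2(x)=x^2+x$, $\varphi_3(x)=x^3+3x^2+x$. Since $S(p+1,0)=0$ for every positive integer $p$, $\varphi_{p+1}(t)/t$ is a polynomial in $t$. For complex $x$ the integral is taken along the line segment from $0$ to $x$. *)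

theory Defs
  imports "HOL-Complex_Analysis.Complex_Analysis" "HOL-Combinatorics.Stirling"
begin

definition exponential_poly :: "nat \<Rightarrow> 'a::field_char_0 \<Rightarrow> 'a" where
  "exponential_poly m x = (\<Sum>k=0..m. of_nat (Stirling m k) * x ^ k)"

text \<open>At \<open>t = 0\<close> Isabelle's total division gives 0 here instead of the value \<open>S(m,1)\<close> of the
  polynomial. That is a single parameter value on any nondegenerate segment starting at 0,
  so integrals along such segments are not affected.\<close>

definition exponential_poly_quot :: "nat \<Rightarrow> 'a::field_char_0 \<Rightarrow> 'a" where
  "exponential_poly_quot m t = exponential_poly m t / t"

definition power_sum_term :: "'a::{real_normed_field,banach} \<Rightarrow> nat \<Rightarrow> nat \<Rightarrow> 'a" where
  "power_sum_term x p n = (\<Sum>j=1..n. of_nat j ^ p) * (x ^ n / fact n)"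

text \<open>The shift to \<open>Suc n\<close> makes the series start at index 1.\<close>

definition power_sum_series :: "'a::{real_normed_field,banach} \<Rightarrow> nat \<Rightarrow> 'a" where
  "power_sum_series x p = (\<Sum>n. power_sum_term x p (Suc n))"

end

(* Expanding j^(p+1) in falling factorials and dividing by j gives
   j^p = sum_k S(p+1,k) (j-1)(j-2)...(j-k+1); summing over j <= n turns each falling factorial
   into n(n-1)...(n-k+1)/k. The exponential generating function of the latter is x^k e^x / k,
   and x^k / k is the integral of t^(k-1). *)
theory Submission
  imports Defs
begin

text \<open>The product \<open>fact k * (j choose k)\<close> is the falling factorial of
  \<open>j\<close> of length \<open>k\<close>, written so that everything stays in the naturals.
  Multiplying by \<open>j\<close> acts on binomials as in \<open>absorb\<close>, which matches the
  recurrence S(m+1,k+1) = (k+1) S(m,k+1) + S(m,k).\<close>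

lemma power_eq_sum_Stirling_binomial:
  "j ^ m = (\<Sum>k\<le>m. Stirling m k * fact k * (j choose k))"
proof (induction m)
  case (Suc m)
  have absorb: "j * (j choose k) = k * (j choose k) + Suc k * (j choose Suc k)" for k
  proof (cases "k \<le> j")
    case True
    have "Suc k * (j choose Suc k) = (j choose k) * (j - k)"
      using binomial_absorb_comp[of j k] binomial_absorption[of k j] by (simp add: mult.commute)
    then show ?thesis
      using True by (simp add: algebra_simps flip: add_mult_distrib2)
  qed (simp add: binomial_eq_0)
  define g where "g k = k * Stirling m k * fact k * (j choose k)" for k
  \<comment> \<open>Both boundary terms vanish: \<open>g 0\<close> through its factor
    \<open>k\<close>, and \<open>g (Suc m)\<close> because S(m,m+1) = 0.\<close>
  have shift: "(\<Sum>k\<le>m. g k) = (\<Sum>k\<le>m. g (Suc k))"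
    using sum.atMost_Suc_shift[of g m] by (simp add: g_def)
  have "j ^ Suc m = (\<Sum>k\<le>m. Stirling m k * fact k * (j * (j choose k)))"
    by (simp add: Suc.IH sum_distrib_left mult_ac)
  also have "\<dots> = (\<Sum>k\<le>m. g k) + (\<Sum>k\<le>m. Stirling m k * fact (Suc k) * (j choose Suc k))"
    unfolding absorb g_def sum.distrib[symmetric]
    by (intro sum.cong) (simp_all add: algebra_simps)
  also have "\<dots> = (\<Sum>k\<le>m. Stirling (Suc m) (Suc k) * fact (Suc k) * (j choose Suc k))"
    unfolding shift unfolding g_def sum.distrib[symmetric]
    by (intro sum.cong) (simp_all add: algebra_simps)
  also have "\<dots> = (\<Sum>k\<le>Suc m. Stirling (Suc m) k * fact k * (j choose k))"
    by (subst sum.atMost_Suc_shift) simp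
  finally show ?case .
qed simp

text \<open>By Pascal's rule the right side grows by the same sum with \<open>n choose k\<close>
  when \<open>n\<close> increases by one, so that sum must equal (n+1)^p.\<close>

lemma sum_powers_eq_sum_Stirling_binomial:
  "(\<Sum>j=1..n. j ^ p) = (\<Sum>k\<le>p. Stirling (Suc p) (Suc k) * fact k * (n choose Suc k))"
proof (induction n)
  case (Suc n)
  \<comment> \<open>Division by n+1 is replaced by cancellation: multiplied by n+1, the sum becomes
    the expansion of (n+1)^(p+1), whose term at k = 0 is zero.\<close>
  have "Suc n * (\<Sum>k\<le>p. Stirling (Suc p) (Suc k) * fact k * (n choose k))
      = (\<Sum>k\<le>p. Stirling (Suc p) (Suc k) * fact k * (Suc n * (n choose k)))"
    by (simp only: sum_distrib_left mult_ac)
  also have "\<dots> = (\<Sum>k\<le>p. Stirling (Suc p) (Suc k) * fact (Suc k) * (Suc n choose Suc k))"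
    by (simp only: Suc_times_binomial_eq fact_Suc mult_ac of_nat_id)
  also have "\<dots> = Suc n * Suc n ^ p"
    using power_eq_sum_Stirling_binomial[of "Suc n" "Suc p"]
    by (subst (asm) sum.atMost_Suc_shift) simp
  finally have "Suc n ^ p = (\<Sum>k\<le>p. Stirling (Suc p) (Suc k) * fact k * (n choose k))"
    by (metis mult_cancel1 nat.distinct(1))
  with Suc.IH show ?case
    by (simp add: sum.distrib algebra_simps del: Stirling.simps)
qed simp

text \<open>Terms with n < k vanish; after a shift by \<open>k\<close>, the identity C(n+k,k)/(n+k)!
  = 1/(k! n!) leaves a multiple of the exponential series.\<close>

lemma binomial_exp_sums:
  fixes x :: "'a::{real_normed_field,banach}"
  shows "(\<lambda>n. of_nat (n choose k) * (x ^ n / fact n)) sums (x ^ k / fact k * exp x)"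
proof (rule sums_zero_iff_shift[where n = k, THEN iffD1])
  have "of_nat ((n + k) choose k) * (x ^ (n + k) / fact (n + k))
      = x ^ k / fact k * (x ^ n /\<^sub>R fact n)" for n
    by (simp add: binomial_fact scaleR_conv_of_real power_add divide_simps)
  then show "(\<lambda>n. of_nat ((n + k) choose k) * (x ^ (n + k) / fact (n + k)))
      sums (x ^ k / fact k * exp x)"
    by (simp only: sums_mult exp_converges)
qed simp

lemma power_sum_term_sums:
  fixes x :: "'a::{real_normed_field,banach}"
  shows "(\<lambda>n. power_sum_term x p (Suc n)) sums
    (exp x * (\<Sum>k=1..p+1. 1 / of_nat k * of_nat (Stirling (p + 1) k) * x ^ k))"
proof -
  \<comment> \<open>This lets the series be summed from index 0 and then restarted at index
    1.\<close>
  have power_sum_term_0: "power_sum_term x p 0 = 0"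
    by (simp add: power_sum_term_def)
  have "power_sum_term x p n = (\<Sum>k\<le>p. of_nat (Stirling (Suc p) (Suc k) * fact k)
      * (of_nat (n choose Suc k) * (x ^ n / fact n)))" for n
  proof -
    have "(\<Sum>j=1..n. of_nat j ^ p :: 'a) = of_nat (\<Sum>j=1..n. j ^ p)"
      by simp
    then show ?thesis
      unfolding power_sum_term_def sum_powers_eq_sum_Stirling_binomial
      by (simp add: sum_distrib_left sum_divide_distrib mult_ac del: Stirling.simps)
  qed
  then have "power_sum_term x p = (\<lambda>n. \<Sum>k\<le>p. of_nat (Stirling (Suc p) (Suc k) * fact k)
      * (of_nat (n choose Suc k) * (x ^ n / fact n)))"
    by (rule ext)
  also have "\<dots> sums (\<Sum>k\<le>p. of_nat (Stirling (Suc p) (Suc k) * fact k)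
      * (x ^ Suc k / fact (Suc k) * exp x))"
    by (intro sums_sum sums_mult binomial_exp_sums)
  \<comment> \<open>The quotient of \<open>fact k\<close> by \<open>fact (Suc k)\<close> is the
    source of the coefficient 1/k after reindexing.\<close>
  also have "(\<Sum>k\<le>p. of_nat (Stirling (Suc p) (Suc k) * fact k)
      * (x ^ Suc k / fact (Suc k) * exp x))
      = exp x * (\<Sum>k\<le>p. 1 / of_nat (Suc k) * of_nat (Stirling (Suc p) (Suc k)) * x ^ Suc k)"
    unfolding sum_distrib_left
    by (intro sum.cong) (simp_all add: divide_simps del: Stirling.simps of_nat_Suc)
  also have "(\<Sum>k\<le>p. 1 / of_nat (Suc k) * of_nat (Stirling (Suc p) (Suc k)) * x ^ Suc k)
      = (\<Sum>k=1..p+1. 1 / of_nat k * of_nat (Stirling (p + 1) k) * x ^ k)"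
    by (simp add: atMost_atLeast0 sum.atLeast_Suc_atMost_Suc_shift del: Stirling.simps of_nat_Suc
        sum.cl_ivl_Suc)
  finally show ?thesis
    unfolding sums_Suc_iff by (simp only: power_sum_term_0 add_0_right)
qed

lemma exponential_poly_quot_eq:
  assumes "t \<noteq> 0" "m > 0"
  shows "exponential_poly_quot m t = (\<Sum>k=1..m. of_nat (Stirling m k) * t ^ (k - 1))"
proof -
  have "Stirling m 0 = 0"
    using assms by (cases m) auto
  then have "exponential_poly m t = (\<Sum>k=1..m. of_nat (Stirling m k) * t ^ k)"
    by (simp add: exponential_poly_def sum.atLeast_Suc_atMost)
  also have "\<dots> = (\<Sum>k=1..m. of_nat (Stirling m k) * t ^ (k - 1) * t)"
    by (intro sum.cong) (auto simp: power_eq_if)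
  finally show ?thesis
    using assms by (simp add: exponential_poly_quot_def flip: sum_distrib_right)
qed

text \<open>The general field and the set \<open>S\<close> make one primitive serve both the real
  interval integral and the complex contour integral.\<close>

lemma exponential_poly_quot_primitive:
  fixes t :: "'a::real_normed_field"
  shows "((\<lambda>t. \<Sum>k=1..m. 1 / of_nat k * of_nat (Stirling m k) * t ^ k) has_field_derivative
    (\<Sum>k=1..m. of_nat (Stirling m k) * t ^ (k - 1))) (at t within S)"
  by (rule DERIV_sum) (auto intro!: derivative_eq_intros)

lemma exponential_poly_quot_interval:
  fixes x :: real
  assumes "m > 0"
  shows "interval_lebesgue_integrable lborel (ereal 0) (ereal x) (exponential_poly_quot m)" (is ?int)
    and "(LBINT t=ereal 0..ereal x. exponential_poly_quot m t)
      = (\<Sum>k=1..m. 1 / of_nat k * of_nat (Stirling m k) * x ^ k)" (is ?val)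
proof -
  let ?q = "\<lambda>t::real. \<Sum>k=1..m. of_nat (Stirling m k) * t ^ (k - 1)"
  \<comment> \<open>The interval is open with 0 as an endpoint, for either sign of \<open>x\<close>,
    so the quotient is never evaluated at 0.\<close>
  have eq: "exponential_poly_quot m t = ?q t"
    if "t \<in> einterval (min (ereal 0) (ereal x)) (max (ereal 0) (ereal x))" for t
    using that assms by (intro exponential_poly_quot_eq) (auto simp: einterval_iff min_def max_def split: if_splits)
  have "interval_lebesgue_integrable lborel (ereal 0) (ereal x) ?q"
    by (rule interval_integrable_isCont) (intro continuous_intros)
  moreover have "interval_lebesgue_integrable lborel (ereal 0) (ereal x) (exponential_poly_quot m)
      = interval_lebesgue_integrable lborel (ereal 0) (ereal x) ?q"
    unfolding interval_lebesgue_integrable_def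
    by (intro if_cong set_integrable_cong refl eq) (simp_all add: min_def max_def)
  ultimately show ?int
    by simp
  have "(LBINT t=ereal 0..ereal x. exponential_poly_quot m t) = (LBINT t=ereal 0..ereal x. ?q t)"
    by (rule interval_integral_cong) (rule eq)
  also have "\<dots> = (\<Sum>k=1..m. 1 / of_nat k * of_nat (Stirling m k) * x ^ k)
      - (\<Sum>k=1..m. 1 / of_nat k * of_nat (Stirling m k) * 0 ^ k)"
    by (intro interval_integral_FTC_finite continuous_intros
        exponential_poly_quot_primitive
          [THEN has_real_derivative_iff_has_vector_derivative[THEN iffD1]])
  finally show ?val
    by (simp add: sum.neutral)
qed

lemma exponential_poly_quot_contour:
  assumes "m > 0"
  shows "(exponential_poly_quot m has_contour_integral
    (\<Sum>k=1..m. 1 / of_nat k * of_nat (Stirling m k) * x ^ k)) (linepath 0 x)"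
\<comment> \<open>On the degenerate path every parameter maps to 0, so changing the integrand at
  finitely many parameters does not cover this case.\<close>
proof (cases "x = 0")
  case True
  then show ?thesis
    by (simp add: has_contour_integral_trivial sum.neutral)
next
  case False
  let ?q = "\<lambda>t::complex. \<Sum>k=1..m. of_nat (Stirling m k) * t ^ (k - 1)"
  let ?P = "\<lambda>t::complex. \<Sum>k=1..m. 1 / of_nat k * of_nat (Stirling m k) * t ^ k"
  have "(?q has_contour_integral (?P (pathfinish (linepath 0 x)) - ?P (pathstart (linepath 0 x))))
      (linepath 0 x)"
    by (rule contour_integral_primitive[where S = UNIV])
      (intro exponential_poly_quot_primitive valid_path_linepath subset_UNIV)+
  then have "(?q has_contour_integral ?P x) (linepath 0 x)"
    by (simp add: sum.neutral)
  then show ?thesis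
    unfolding has_contour_integral_linepath
  \<comment> \<open>For nonzero \<open>x\<close> the segment meets 0 only at parameter 0, so
    quotient and polynomial have the same integral.\<close>
  proof (rule has_integral_spike_finite[where S = "{0}", rotated 2])
    fix t :: real assume "t \<in> {0..1} - {0}"
    with False assms show "exponential_poly_quot m (linepath 0 x t) * (x - 0)
        = ?q (linepath 0 x t) * (x - 0)"
      by (subst exponential_poly_quot_eq) (auto simp: linepath_def)
  qed simp
qed

theorem mainTheorem1:
  fixes p :: nat
  assumes "p > 0"
  shows "(\<forall>x::real.
      summable (\<lambda>n. power_sum_term x p (Suc n)) \<and>
      interval_lebesgue_integrable lborel (ereal 0) (ereal x) (exponential_poly_quot (p + 1)) \<and>
      power_sum_series x p
        = exp x * (LBINT t=ereal 0..ereal x. exponential_poly_quot (p + 1) t) \<and>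
      exp x * (LBINT t=ereal 0..ereal x. exponential_poly_quot (p + 1) t)
        = exp x * (\<Sum>k=1..p+1. 1 / of_nat k * of_nat (Stirling (p + 1) k) * x ^ k))
    \<and> (\<forall>x::complex.
      summable (\<lambda>n. power_sum_term x p (Suc n)) \<and>
      exponential_poly_quot (p + 1) contour_integrable_on (linepath 0 x) \<and>
      power_sum_series x p
        = exp x * contour_integral (linepath 0 x) (exponential_poly_quot (p + 1)) \<and>
      exp x * contour_integral (linepath 0 x) (exponential_poly_quot (p + 1))
        = exp x * (\<Sum>k=1..p+1. 1 / of_nat k * of_nat (Stirling (p + 1) k) * x ^ k))"
proof -
  have real_int: "interval_lebesgue_integrable lborel (ereal 0) (ereal x) (exponential_poly_quot (p + 1))"
    "(LBINT t=ereal 0..ereal x. exponential_poly_quot (p + 1) t)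
      = (\<Sum>k=1..p+1. 1 / of_nat k * of_nat (Stirling (p + 1) k) * x ^ k)" for x :: real
    by (rule exponential_poly_quot_interval, simp)+
  have contour: "(exponential_poly_quot (p + 1) has_contour_integral
    (\<Sum>k=1..p+1. 1 / of_nat k * of_nat (Stirling (p + 1) k) * x ^ k)) (linepath 0 x)" for x
    by (rule exponential_poly_quot_contour) simp
  \<comment> \<open>Once both integrals are rewritten as the Stirling sum, the last equality in each
    half is reflexive and the one before it is uniqueness of the sum of the series.\<close>
  show ?thesis
    unfolding power_sum_series_def real_int(2) contour[THEN contour_integral_unique]
    by (intro conjI allI refl real_int(1) has_contour_integral_integrable[OF contour]
        sums_summable[OF power_sum_term_sums] sums_unique[OF power_sum_term_sums, symmetric])
qed

end
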